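(* The Leibniz rule $${}_a^{C}\mathscr{D}_t^\alpha\{f(t)g(t)\}=\sum_{j=0}^{+\infty}\binom{\alpha}{j}f^{(j)}(t)\,{}_a^{C}\mathscr{D}_t^{\alpha-j}g(t)$$ for the Caputo derivative does not hold in general. That is, it is not true that this identity is valid for all $n\in\mathbb{N}_+$, all $\alpha\in(n-1,n)$, all reals $a<b$, all functions $f:[a,b]\to\mathbb{R}$ that can be expressed as a Taylor series (in the sense of the context), all $n$ times continuously differentiable $g:[a,b]\to\mathbb{R}$, and all $t\in(a,b]$.
   Context: For $\beta>0$ the Riemann--Liouville fractional integral with lower terminal $a$ is ${}_a^{R}\mathscr{I}_t^{\beta}h(t)=\frac{1}{\Gamma(\beta)}\int_a^t(t-\tau)^{\beta-1}h(\tau)\,d\tau$. For $m\in\mathbb{N}_+$ and $\beta\in(m-1,m)$ the Caputo derivative is ${}_a^{C}\mathscr{D}_t^{\beta}h(t)={}_a^{R}\mathscr{I}_t^{m-\beta}h^{(m)}(t)$. For negative order, the convention is ${}_a^{C}\mathscr{D}_t^{-\beta}h(t)={}_a^{R}\mathscr{I}_t^{\beta}h(t)$ for $\beta>0$; thus for $\alpha\in(n-1,n)$, ${}_a^{C}\mathscr{D}_t^{\alpha-j}$ is a genuine Caputo derivative of order $\alpha-j$ for $0\le j\le n-1$, and equals ${}_a^{R}\mathscr{I}_t^{j-\alpha}$ for $j\ge n$. The generalized binomial coefficient is $\binom{\alpha}{j}=\frac{\alpha(\alpha-1)\cdots(\alpha-j+1)}{j!}$ with $\binom{\alpha}{0}=1$.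 "$f$ can be expressed as a Taylor series" means: $f$ is infinitely differentiable on $[a,b]$ and for each $t\in(a,b]$ one has the convergent expansion $f(\tau)=\sum_{k=0}^{+\infty}\frac{f^{(k)}(t)}{k!}(\tau-t)^k$ for all $\tau\in[a,t]$. All derivatives at end points are one-sided. *)

theory Defs
  imports "HOL-Analysis.Analysis"
begin

text \<open>
  A function on [a,b] is represented by a total function of which only the values on [a,b] matter.
  Derivatives are therefore taken within {a..b}: two-sided at interior points,
  one-sided at the end points.
\<close>

primrec nth_deriv_within :: "real set \<Rightarrow> nat \<Rightarrow> (real \<Rightarrow> real) \<Rightarrow> real \<Rightarrow> real" where
  "nth_deriv_within S 0 h = h"
| "nth_deriv_within S (Suc k) h =
     (\<lambda>x. vector_derivative (nth_deriv_within S k h) (at x within S))"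

definition n_times_cont_diff_on :: "nat \<Rightarrow> (real \<Rightarrow> real) \<Rightarrow> real set \<Rightarrow> bool" where
  "n_times_cont_diff_on n h S \<longleftrightarrow>
     (\<forall>k<n. nth_deriv_within S k h differentiable_on S) \<and>
     continuous_on S (nth_deriv_within S n h)"

definition infinitely_diff_on :: "(real \<Rightarrow> real) \<Rightarrow> real set \<Rightarrow> bool" where
  "infinitely_diff_on h S \<longleftrightarrow> (\<forall>k. nth_deriv_within S k h differentiable_on S)"

definition taylor_expressible_on :: "real \<Rightarrow> real \<Rightarrow> (real \<Rightarrow> real) \<Rightarrow> bool" where
  "taylor_expressible_on a b f \<longleftrightarrow>
     infinitely_diff_on f {a..b} \<and>
     (\<forall>t\<in>{a<..b}. \<forall>\<tau>\<in>{a..t}.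
        (\<lambda>k. nth_deriv_within {a..b} k f t / fact k * (\<tau> - t) ^ k) sums f \<tau>)"

text \<open>Meaningful for \<open>\<beta> > 0\<close>.\<close>

definition rl_integral :: "real \<Rightarrow> real \<Rightarrow> (real \<Rightarrow> real) \<Rightarrow> real \<Rightarrow> real" where
  "rl_integral a \<beta> h t =
     1 / Gamma \<beta> * integral {a..t} (\<lambda>\<tau>. (t - \<tau>) powr (\<beta> - 1) * h \<tau>)"

text \<open>
  Meaningful for non-integer \<open>\<beta>\<close> and \<open>t\<close> in (a,b]. For \<open>\<beta>\<close> in (m-1,m) with
  \<open>m \<ge> 1\<close> the ceiling of \<open>\<beta>\<close> is m. The upper end b only serves to fix the domain
  within which \<open>h\<close> is differentiated.
\<close>

definition caputo :: "real \<Rightarrow> real \<Rightarrow> real \<Rightarrow> (real \<Rightarrow> real) \<Rightarrow> real \<Rightarrow> real" where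
  "caputo a b \<beta> h t =
     (if \<beta> > 0
      then rl_integral a (of_int \<lceil>\<beta>\<rceil> - \<beta>) (nth_deriv_within {a..b} (nat \<lceil>\<beta>\<rceil>) h) t
      else rl_integral a (- \<beta>) h t)"

end

theory Submission
  imports Defs
begin

text \<open>
  The counterexample is \<open>\<alpha> = 1/2\<close>, \<open>f s = s\<close>, \<open>g = 1\<close> on [0,1] at \<open>t = 1\<close>. The Caputo derivative
  of a constant vanishes, so the only surviving term of the series is the one for \<open>j = 1\<close>, namely
  half the integral of order 1/2 of the constant 1; the left-hand side is that whole integral,
  which is positive.
\<close>

lemma differentiable_on_eq:
  assumes "f differentiable_on S" "\<And>x. x \<in> S \<Longrightarrow> g x = f x"
  shows "g differentiable_on S"
  using assms unfolding differentiable_on_def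
  by (metis differentiable_transform_within zero_less_one)

text \<open>A derivative within \<open>{a..b}\<close> depends only on values in
  \<open>{a..b}\<close>, so a closed form \<open>F\<close> valid there can be differentiated
  instead. It is unique because \<open>a < b\<close> makes the interval nondegenerate, which turns
  \<open>has_vector_derivative\<close> into an equation.\<close>

lemma nth_deriv_within_Suc_eq:
  assumes "a < b" "x \<in> {a..b}"
    and "\<And>y. y \<in> {a..b} \<Longrightarrow> nth_deriv_within {a..b} k h y = F y"
    and "(F has_vector_derivative F') (at x within {a..b})"
  shows "nth_deriv_within {a..b} (Suc k) h x = F'"
proof -
  have "(nth_deriv_within {a..b} k h has_vector_derivative F') (at x within {a..b})"
    using has_vector_derivative_transform[OF assms(2) _ assms(4)] assms(3) by simp
  then show ?thesis
    using assms(1,2) by (simp add: vector_derivative_within_closed_interval)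
qed

lemma nth_deriv_within_const:
  assumes "a < b" "x \<in> {a..b}"
  shows "nth_deriv_within {a..b} k (\<lambda>_. c) x = (if k = 0 then c else 0)"
  using assms(2)
proof (induction k arbitrary: x)
  case (Suc k)
  show ?case
    using nth_deriv_within_Suc_eq[OF assms(1) Suc.prems Suc.IH, of 0] by (auto split: if_splits)
qed simp

lemma nth_deriv_within_ident:
  assumes "a < b" "x \<in> {a..b}"
  shows "nth_deriv_within {a..b} k (\<lambda>s. s) x = (if k = 0 then x else if k = 1 then 1 else 0)"
  using assms(2)
proof (induction k arbitrary: x)
  case (Suc k)
  have "((\<lambda>y. if k = 0 then y else if k = 1 then 1 else 0)
          has_vector_derivative (if k = 0 then 1 else 0)) (at x within {a..b})"
    by (cases "k = 0"; cases "k = 1") (auto intro!: derivative_eq_intros)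
  from nth_deriv_within_Suc_eq[OF assms(1) Suc.prems Suc.IH this] show ?case by simp
qed simp

lemma taylor_expressible_on_ident:
  assumes "a < b"
  shows "taylor_expressible_on a b (\<lambda>s. s)"
  unfolding taylor_expressible_on_def infinitely_diff_on_def
proof (intro conjI allI ballI)
  fix k :: nat
  have "(\<lambda>y::real. if k = 0 then y else if k = 1 then 1 else 0) differentiable_on {a..b}"
    by (cases "k = 0"; cases "k = 1") auto
  then show "nth_deriv_within {a..b} k (\<lambda>s. s) differentiable_on {a..b}"
    by (rule differentiable_on_eq) (simp add: nth_deriv_within_ident[OF assms])
next
  fix t \<tau> assume "t \<in> {a<..b}"
  then have "nth_deriv_within {a..b} k (\<lambda>s. s) t = (if k = 0 then t else if k = 1 then 1 else 0)" for k
    using nth_deriv_within_ident[OF assms, of t k] by simp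
  \<comment> \<open>Only the terms for \<open>k = 0\<close> and \<open>k = 1\<close> survive, and
    they add up to \<open>t + (\<tau> - t)\<close>.\<close>
  then show "(\<lambda>k. nth_deriv_within {a..b} k (\<lambda>s. s) t / fact k * (\<tau> - t) ^ k) sums \<tau>"
    using sums_finite[of "{0, 1}" "\<lambda>k. nth_deriv_within {a..b} k (\<lambda>s. s) t / fact k * (\<tau> - t) ^ k"]
    by simp
qed

lemma n_times_cont_diff_on_const:
  assumes "a < b"
  shows "n_times_cont_diff_on n (\<lambda>_. c) {a..b}"
proof -
  have "nth_deriv_within {a..b} k (\<lambda>_. c) differentiable_on {a..b}" for k
    using differentiable_on_const[of "if k = 0 then c else 0"]
    by (rule differentiable_on_eq) (simp add: nth_deriv_within_const[OF assms])
  then show ?thesis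
    by (simp add: n_times_cont_diff_on_def differentiable_imp_continuous_on)
qed

text \<open>Needed because the closed forms of the iterated derivatives are known only inside the
  interval.\<close>

lemma rl_integral_cong:
  assumes "\<And>\<tau>. \<tau> \<in> {a..t} \<Longrightarrow> h \<tau> = h' \<tau>"
  shows "rl_integral a \<beta> h t = rl_integral a \<beta> h' t"
  unfolding rl_integral_def using assms by (auto intro!: integral_cong)

lemma rl_integral_half_one_pos:
  assumes "a < t"
  shows "rl_integral a (1/2) (\<lambda>_. 1) t > 0"
proof -
  have "((\<lambda>\<tau>. (t - \<tau>) powr (- 1/2)) has_integral (- 2 * sqrt (t - t) - (- 2 * sqrt (t - a)))) {a..t}"
  \<comment> \<open>The kernel is unbounded near \<open>t\<close>, where its primitive
    \<open>- 2 * sqrt (t - \<tau>)\<close> is continuous but not differentiable; the interior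
    version asks for the derivative only on the open interval.\<close>
  proof (rule fundamental_theorem_of_calculus_interior)
    show "continuous_on {a..t} (\<lambda>\<tau>. - 2 * sqrt (t - \<tau>))"
      by (intro continuous_intros)
    fix x assume "x \<in> {a<..<t}"
    then show "((\<lambda>\<tau>. - 2 * sqrt (t - \<tau>)) has_vector_derivative (t - x) powr (- 1/2)) (at x)"
      unfolding has_real_derivative_iff_has_vector_derivative[symmetric]
      by (auto intro!: derivative_eq_intros simp: powr_minus powr_half_sqrt divide_simps)
  qed (use assms in simp)
  then have "integral {a..t} (\<lambda>\<tau>. (t - \<tau>) powr (- 1/2)) = 2 * sqrt (t - a)"
    by (simp add: integral_unique)
  then show ?thesis
    using assms by (simp add: rl_integral_def Gamma_real_pos)
qed

theorem proposition3p3: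
  "\<not> (\<forall>(n::nat) (\<alpha>::real) (a::real) (b::real) (f::real \<Rightarrow> real) (g::real \<Rightarrow> real) (t::real).
        n \<ge> 1 \<longrightarrow> real n - 1 < \<alpha> \<longrightarrow> \<alpha> < real n \<longrightarrow> a < b \<longrightarrow>
        taylor_expressible_on a b f \<longrightarrow> n_times_cont_diff_on n g {a..b} \<longrightarrow> t \<in> {a<..b} \<longrightarrow>
        (\<lambda>j. (\<alpha> gchoose j) * nth_deriv_within {a..b} j f t * caputo a b (\<alpha> - real j) g t)
          sums caputo a b \<alpha> (\<lambda>s. f s * g s) t)"
proof
  assume leibniz: "\<forall>(n::nat) (\<alpha>::real) (a::real) (b::real) (f::real \<Rightarrow> real) (g::real \<Rightarrow> real) (t::real).
        n \<ge> 1 \<longrightarrow> real n - 1 < \<alpha> \<longrightarrow> \<alpha> < real n \<longrightarrow> a < b \<longrightarrow>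
        taylor_expressible_on a b f \<longrightarrow> n_times_cont_diff_on n g {a..b} \<longrightarrow> t \<in> {a<..b} \<longrightarrow>
        (\<lambda>j. (\<alpha> gchoose j) * nth_deriv_within {a..b} j f t * caputo a b (\<alpha> - real j) g t)
          sums caputo a b \<alpha> (\<lambda>s. f s * g s) t"
  define I where "I = rl_integral 0 (1/2) (\<lambda>_. 1) 1"
  \<comment> \<open>Order 1/2 thus means: differentiate once, then integrate to order 1 - 1/2 =
    1/2.\<close>
  have ceiling_half: "\<lceil>1/2 :: real\<rceil> = 1"
    by (simp add: ceiling_eq_iff)
  define u where "u = (\<lambda>j. ((1/2::real) gchoose j) * nth_deriv_within {0..1} j (\<lambda>s. s) 1
      * caputo 0 1 (1/2 - real j) (\<lambda>_. 1) 1)"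
  have "u sums caputo 0 1 (1/2) (\<lambda>s. s * 1) 1"
    unfolding u_def
    using leibniz[rule_format, of 1 "1/2" 0 1 "\<lambda>s. s" "\<lambda>_. 1" 1]
      taylor_expressible_on_ident[of 0 1] n_times_cont_diff_on_const[of 0 1 1 1] by simp
  moreover have "caputo 0 1 (1/2) (\<lambda>s. s * 1) 1 = I"
  proof -
    have "caputo 0 1 (1/2) (\<lambda>s. s * 1) 1
        = rl_integral 0 (1/2) (nth_deriv_within {0..1} 1 (\<lambda>s. s)) 1"
      unfolding caputo_def ceiling_half by simp
    also have "\<dots> = I"
      unfolding I_def using nth_deriv_within_ident[of 0 1 _ 1] by (intro rl_integral_cong) simp
    finally show ?thesis .
  qed
  moreover have "u sums (I / 2)"
  proof -
    have "caputo 0 1 (1/2) (\<lambda>_. 1) 1 = rl_integral 0 (1/2) (nth_deriv_within {0..1} 1 (\<lambda>_. 1)) 1"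
      unfolding caputo_def ceiling_half by simp
    also have "\<dots> = rl_integral 0 (1/2) (\<lambda>_. 0) 1"
      using nth_deriv_within_const[of 0 1 _ 1 1] by (intro rl_integral_cong) simp
    also have "\<dots> = 0"
      by (simp add: rl_integral_def)
    finally have u0: "u 0 = 0"
      by (simp add: u_def)
    \<comment> \<open>For \<open>j = 1\<close> the order is -1/2, so \<open>caputo\<close> takes its
      integral branch and gives \<open>I\<close>. The factor 1/2 is the binomial coefficient; the
      derivative of the identity contributes 1.\<close>
    have u1: "u 1 = I / 2"
      using nth_deriv_within_ident[of 0 1 1 1] by (simp add: u_def I_def caputo_def)
    \<comment> \<open>From \<open>j = 2\<close> on, the derivatives of the identity vanish.\<close>
    have "u j = 0" if "j \<notin> {0, 1}" for j
      using that nth_deriv_within_ident[of 0 1 1 j] by (simp add: u_def)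
    then have "u sums (\<Sum>j\<in>{0, 1}. u j)"
      by (intro sums_finite) auto
    also have "(\<Sum>j\<in>{0, 1}. u j) = I / 2"
      using u0 u1 by simp
    finally show ?thesis .
  qed
  \<comment> \<open>A series has at most one sum; the resulting equation would force
    \<open>I = 0\<close>.\<close>
  ultimately have "I = I / 2"
    using sums_unique2 by metis
  then show False
    using rl_integral_half_one_pos[of 0 1] by (simp add: I_def)
qed

end
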